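(* Let $X$ be a nonempty set, let $F\colon X^2\to X$ be an operation, and let $F'=F|_{\mathrm{ran}(F)^2}$, viewed as an operation on the set $Y=\mathrm{ran}(F)$. The following assertions are equivalent. (i) $F$ is $(1,4)$-selective. (ii) $F(u,v)=F(F(u,u),F(v,v))$ for all $u,v\in X$, and $F'\colon Y^2\to Y$ satisfies all of the following conditions: (ii.1) $F'$ is $(1,4)$-selective and satisfies any of the following conditions: $F'$ is anticommutative; $F'$ is surjective onto $Y$; $F'$ is idempotent; $\sim_{F',1}$ is an equivalence relation on $Y$; $\sim_{F',2}$ is an equivalence relation on $Y$. (ii.2) $\sim_{F',1}$ and $\sim_{F',2}$ are equivalence relations on $Y$ such that $[x]_{\sim_{F',2}}\cap[y]_{\sim_{F',1}}=\{F'(x,y)\}$ for all $x,y\in Y$. (ii.3) $\sim_{F',1}$ and $\sim_{F',2}$ are equivalence relations on $Y$; for all $x,y,z\in Y$ such that $x\in[y]_{\sim_{F',1}}$ there exists a unique $u\in[z]_{\sim_{F',1}}$ such that $x\sim_{F',2}u$; and $F'(x,y)=F'(x,z)$ for all $x,y,z\in Y$ such that $y\sim_{F',1}z$. (iii) $F(u,v)=F(F(u,u),F(v,v))$ for all $u,v\in X$, and $F'\colon Y^2\to Y$ satisfies both of the following conditions: (iii.1) $\sim_{F',1}$ and $\sim_{F',2}$ are equivalence relations on $Y$, and for all $x,y\in Y$ there exists a bijection $f\colon[x]_{\sim_{F',1}}\to[y]_{\sim_{F',1}}$ defined by $f(u)=v\Leftrightarrow u\sim_{F',2}v$ for $u\in[x]_{\sim_{F',1}}$,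 $v\in[y]_{\sim_{F',1}}$ (that is, this rule defines a bijection). (iii.2) $F'(x,y)=F'(x,z)$ for all $x,y,z\in Y$ such that $y\sim_{F',1}z$.
   Context: An operation $G\colon Z^2\to Z$ on a nonempty set $Z$ is $(1,4)$-selective if $G(G(x_1,x_2),G(x_3,x_4))=G(x_1,x_4)$ for all $x_1,x_2,x_3,x_4\in Z$; idempotent if $G(x,x)=x$ for all $x\in Z$; anticommutative if, for all $x,y\in Z$, $G(x,y)=G(y,x)$ implies $x=y$. $\mathrm{ran}(F)$ denotes the range of $F$. The binary relations $\sim_{G,1}$ and $\sim_{G,2}$ on $Z$ are defined by $x\sim_{G,1}y\Leftrightarrow G(x,y)=x$ and $x\sim_{G,2}y\Leftrightarrow G(x,y)=y$ for $x,y\in Z$. When these are equivalence relations, $[x]_{\sim_{G,1}}$ and $[x]_{\sim_{G,2}}$ denote the corresponding equivalence classes of $x$. In (ii.1), the five listed conditions are mutually equivalent for a $(1,4)$-selective operation, so "any" may be read as "at least one" or as "every". *)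

theory Defs
  imports Main "HOL-Library.FuncSet"
begin

definition selective14 :: "'a set \<Rightarrow> ('a \<times> 'a \<Rightarrow> 'a) \<Rightarrow> bool" where
  "selective14 Z G \<longleftrightarrow>
     (\<forall>x1\<in>Z. \<forall>x2\<in>Z. \<forall>x3\<in>Z. \<forall>x4\<in>Z. G (G (x1, x2), G (x3, x4)) = G (x1, x4))"

definition idempotent_op :: "'a set \<Rightarrow> ('a \<times> 'a \<Rightarrow> 'a) \<Rightarrow> bool" where
  "idempotent_op Z G \<longleftrightarrow> (\<forall>x\<in>Z. G (x, x) = x)"

definition anticommutative_op :: "'a set \<Rightarrow> ('a \<times> 'a \<Rightarrow> 'a) \<Rightarrow> bool" where
  "anticommutative_op Z G \<longleftrightarrow> (\<forall>x\<in>Z. \<forall>y\<in>Z. G (x, y) = G (y, x) \<longrightarrow> x = y)"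

definition sim1 :: "'a set \<Rightarrow> ('a \<times> 'a \<Rightarrow> 'a) \<Rightarrow> 'a rel" where
  "sim1 Z G = {(x, y). x \<in> Z \<and> y \<in> Z \<and> G (x, y) = x}"

definition sim2 :: "'a set \<Rightarrow> ('a \<times> 'a \<Rightarrow> 'a) \<Rightarrow> 'a rel" where
  "sim2 Z G = {(x, y). x \<in> Z \<and> y \<in> Z \<and> G (x, y) = y}"

end

theory Submission imports Defs begin

text \<open>
  On its range, a (1,4)-selective operation is idempotent, hence a rectangular band: \<open>F' (x, y)\<close> is
  the unique common element of the \<open>\<sim>\<^sub>2\<close>-class of \<open>x\<close> and the \<open>\<sim>\<^sub>1\<close>-class of \<open>y\<close>. Conversely, an operation
  that picks this common element is selective, because \<open>F' (x, y) \<sim>\<^sub>2 x\<close> and \<open>F' (x, y) \<sim>\<^sub>1 y\<close>. The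
  bijections between \<open>\<sim>\<^sub>1\<close>-classes are the maps \<open>u \<mapsto> F' (u, y)\<close>. The identity
  \<open>F (u, v) = F (F (u, u), F (v, v))\<close> says that \<open>F\<close> is determined by \<open>F'\<close> and the diagonal.
\<close>

locale rectangular_band =
  fixes Z :: "'a set" and G :: "'a \<times> 'a \<Rightarrow> 'a"
  assumes closed: "\<lbrakk>x \<in> Z; y \<in> Z\<rbrakk> \<Longrightarrow> G (x, y) \<in> Z"
    and selective: "selective14 Z G"
    and idempotent: "idempotent_op Z G"
begin

lemma idem: "x \<in> Z \<Longrightarrow> G (x, x) = x"
  using idempotent by (simp add: idempotent_op_def)

text \<open>Replacing \<open>z\<close> by \<open>G (z, z)\<close> makes selectivity applicable.
  Together with \<open>absorb_right\<close> this yields associativity, since both bracketings equal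
  \<open>G (x, z)\<close>.\<close>

lemma absorb_left: "\<lbrakk>x \<in> Z; y \<in> Z; z \<in> Z\<rbrakk> \<Longrightarrow> G (G (x, y), z) = G (x, z)"
  using selective idem unfolding selective14_def by metis

lemma absorb_right: "\<lbrakk>x \<in> Z; y \<in> Z; z \<in> Z\<rbrakk> \<Longrightarrow> G (x, G (y, z)) = G (x, z)"
  using selective idem unfolding selective14_def by metis

lemma sim1_sym: "\<lbrakk>x \<in> Z; y \<in> Z; G (x, y) = x\<rbrakk> \<Longrightarrow> G (y, x) = y"
  by (metis absorb_right idem)

lemma equiv_sim1: "equiv Z (sim1 Z G)"
proof (rule equivI)
  show "sim1 Z G \<subseteq> Z \<times> Z" by (auto simp: sim1_def)
  show "refl_on Z (sim1 Z G)" by (auto simp: sim1_def refl_on_def idem)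
  show "sym (sim1 Z G)"
    using sim1_sym by (auto simp: sim1_def sym_def)
  show "trans (sim1 Z G)"
    using absorb_right by (auto simp: sim1_def trans_def) metis
qed

lemma equiv_sim2: "equiv Z (sim2 Z G)"
proof (rule equivI)
  show "sim2 Z G \<subseteq> Z \<times> Z" by (auto simp: sim2_def)
  show "refl_on Z (sim2 Z G)" by (auto simp: sim2_def refl_on_def idem)
  show "sym (sim2 Z G)"
    using absorb_left idem by (auto simp: sim2_def sym_def) metis
  show "trans (sim2 Z G)"
    using absorb_left by (auto simp: sim2_def trans_def) metis
qed

lemma sim1_cong: "(y, z) \<in> sim1 Z G \<Longrightarrow> x \<in> Z \<Longrightarrow> G (x, y) = G (x, z)"
  using absorb_right by (auto simp: sim1_def) metis

text \<open>Such a \<open>u\<close> satisfies \<open>u = G (x, u)\<close>, and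
  \<open>G (x, u) = G (x, y)\<close> by \<open>sim1_cong\<close>; absorption shows that
  \<open>G (x, y)\<close> qualifies. The class conditions of (ii) and (iii) are read off from
  this.\<close>

lemma sim1_sim2_iff:
  assumes "x \<in> Z" "y \<in> Z"
  shows "(y, u) \<in> sim1 Z G \<and> (x, u) \<in> sim2 Z G \<longleftrightarrow> u = G (x, y)"
proof
  assume "(y, u) \<in> sim1 Z G \<and> (x, u) \<in> sim2 Z G"
  then show "u = G (x, y)"
    using sim1_cong[of y u x] assms by (simp add: sim2_def)
next
  assume "u = G (x, y)"
  then show "(y, u) \<in> sim1 Z G \<and> (x, u) \<in> sim2 Z G"
    using assms by (simp add: sim1_def sim2_def closed absorb_right absorb_left idem)
qed

lemma class_inter:
  "\<lbrakk>x \<in> Z; y \<in> Z\<rbrakk> \<Longrightarrow> sim2 Z G `` {x} \<inter> sim1 Z G `` {y} = {G (x, y)}"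
  using sim1_sim2_iff[of x y] by auto

lemma ex1_class:
  "\<lbrakk>x \<in> Z; z \<in> Z\<rbrakk> \<Longrightarrow> \<exists>!u. u \<in> sim1 Z G `` {z} \<and> (x, u) \<in> sim2 Z G"
  using sim1_sim2_iff[of x z] by simp

lemma class_bij:
  assumes "x \<in> Z" "y \<in> Z"
  shows "bij_betw (\<lambda>u. G (u, y)) (sim1 Z G `` {x}) (sim1 Z G `` {y})"
\<comment> \<open>The inverse swaps the roles of \<open>x\<close> and \<open>y\<close>:
  \<open>G (G (u, y), x) = G (u, x) = u\<close> for \<open>u\<close> in the class of
  \<open>x\<close>.\<close>
proof (rule bij_betw_byWitness[where f' = "\<lambda>v. G (v, x)"])
  show "\<forall>u\<in>sim1 Z G `` {x}. G (G (u, y), x) = u"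
    and "\<forall>v\<in>sim1 Z G `` {y}. G (G (v, x), y) = v"
    using assms by (auto simp: sim1_def absorb_left sim1_sym)
  show "(\<lambda>u. G (u, y)) ` (sim1 Z G `` {x}) \<subseteq> sim1 Z G `` {y}"
    and "(\<lambda>v. G (v, x)) ` (sim1 Z G `` {y}) \<subseteq> sim1 Z G `` {x}"
    using assms by (auto simp: sim1_def closed absorb_right idem)
qed

lemma class_bij_graph:
  "\<lbrakk>u \<in> Z; y \<in> Z; v \<in> sim1 Z G `` {y}\<rbrakk> \<Longrightarrow> G (u, y) = v \<longleftrightarrow> (u, v) \<in> sim2 Z G"
  using sim1_sim2_iff[of u y v] by auto

end

text \<open>\<open>G (a, b)\<close> is \<open>sim2\<close>-related to \<open>a\<close> and
  \<open>G (c, d)\<close> is \<open>sim1\<close>-related to \<open>d\<close>, so the product of the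
  two lies in the \<open>sim2\<close>-class of \<open>a\<close> and the \<open>sim1\<close>-class of
  \<open>d\<close>. These classes meet only in \<open>G (a, d)\<close>: \<open>meet\<close> supplies
  existence, \<open>cong\<close> uniqueness.\<close>

lemma selective14_if_sim_product:
  assumes eq1: "equiv Z (sim1 Z G)" and eq2: "equiv Z (sim2 Z G)"
    and meet: "\<And>x y. \<lbrakk>x \<in> Z; y \<in> Z\<rbrakk> \<Longrightarrow> \<exists>v. (y, v) \<in> sim1 Z G \<and> (x, v) \<in> sim2 Z G"
    and cong: "\<And>x y z. \<lbrakk>x \<in> Z; (y, z) \<in> sim1 Z G\<rbrakk> \<Longrightarrow> G (x, y) = G (x, z)"
  shows "selective14 Z G"
proof -
  have meet_eq: "v = G (x, y)" if "(y, v) \<in> sim1 Z G" "(x, v) \<in> sim2 Z G" for x y v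
    using that cong[of x y v] by (simp add: sim2_def)
  have sims: "(y, G (x, y)) \<in> sim1 Z G" "(x, G (x, y)) \<in> sim2 Z G" if "x \<in> Z" "y \<in> Z" for x y
    using meet[OF that] meet_eq by blast+
  show ?thesis unfolding selective14_def
  proof (intro ballI)
    fix a b c d assume Z: "a \<in> Z" "b \<in> Z" "c \<in> Z" "d \<in> Z"
    define p q where "p = G (a, b)" and "q = G (c, d)"
    have p: "(a, p) \<in> sim2 Z G" and q: "(d, q) \<in> sim1 Z G"
      using sims Z by (auto simp: p_def q_def)
    \<comment> \<open>Closure of \<open>Z\<close> under \<open>G\<close> comes from the relations,
      which live on \<open>Z\<close>.\<close>
    then have "p \<in> Z" "q \<in> Z" by (auto simp: sim1_def sim2_def)
    then have "(d, G (p, q)) \<in> sim1 Z G" "(a, G (p, q)) \<in> sim2 Z G"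
      using sims[of p q] p q eq1 eq2 by (meson equivE transD)+
    then show "G (G (a, b), G (c, d)) = G (a, d)"
      unfolding p_def q_def by (rule meet_eq)
  qed
qed

text \<open>The diagonal identity is selectivity at \<open>u, u, v, v\<close>. Conversely, it
  rewrites \<open>F (a, b)\<close> as a product of the elements \<open>F (a, a)\<close> and
  \<open>F (b, b)\<close> of \<open>Y\<close>, where selectivity is available.\<close>

lemma selective14_range_iff:
  assumes F: "F \<in> X \<times> X \<rightarrow> X"
  defines "Y \<equiv> F ` (X \<times> X)"
  shows "selective14 X F \<longleftrightarrow>
    (\<forall>u\<in>X. \<forall>v\<in>X. F (u, v) = F (F (u, u), F (v, v))) \<and> selective14 Y (restrict F (Y \<times> Y))"
proof -
  have YX: "Y \<subseteq> X" using F by (auto simp: Y_def)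
  have FY: "\<And>u v. \<lbrakk>u \<in> X; v \<in> X\<rbrakk> \<Longrightarrow> F (u, v) \<in> Y" by (auto simp: Y_def)
  \<comment> \<open>All arguments, including the nested values, stay in \<open>Y\<close>, so the
    default value of \<open>restrict\<close> never occurs.\<close>
  have restr: "selective14 Y (restrict F (Y \<times> Y)) \<longleftrightarrow> selective14 Y F"
    using YX FY by (simp add: selective14_def subset_iff)
  show ?thesis
  proof (intro iffI conjI)
    assume "selective14 X F"
    then show "\<forall>u\<in>X. \<forall>v\<in>X. F (u, v) = F (F (u, u), F (v, v))" "selective14 Y (restrict F (Y \<times> Y))"
      using YX unfolding restr by (auto simp: selective14_def subset_iff)
  next
    assume "(\<forall>u\<in>X. \<forall>v\<in>X. F (u, v) = F (F (u, u), F (v, v))) \<and> selective14 Y (restrict F (Y \<times> Y))"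
    then have diag: "\<And>u v. \<lbrakk>u \<in> X; v \<in> X\<rbrakk> \<Longrightarrow> F (u, v) = F (F (u, u), F (v, v))"
      and sel: "selective14 Y F"
      unfolding restr by blast+
    show "selective14 X F" unfolding selective14_def
    proof (intro ballI)
      fix a b c d assume X: "a \<in> X" "b \<in> X" "c \<in> X" "d \<in> X"
      have "F (F (a, b), F (c, d)) = F (F (F (a, a), F (b, b)), F (F (c, c), F (d, d)))"
        using diag X by metis
      also have "\<dots> = F (F (a, a), F (d, d))"
        using sel FY X by (simp add: selective14_def)
      also have "\<dots> = F (a, d)" using diag X by metis
      finally show "F (F (a, b), F (c, d)) = F (a, d)" .
    qed
  qed
qed

lemma rectangular_band_range:
  assumes F: "F \<in> X \<times> X \<rightarrow> X" and sel: "selective14 X F"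
  defines "Y \<equiv> F ` (X \<times> X)"
  shows "rectangular_band Y (restrict F (Y \<times> Y))"
proof
  have "Y \<subseteq> X" using F by (auto simp: Y_def)
  then show "restrict F (Y \<times> Y) (x, y) \<in> Y" if "x \<in> Y" "y \<in> Y" for x y
    using that by (auto simp: Y_def)
  show "selective14 Y (restrict F (Y \<times> Y))"
    using selective14_range_iff[OF F] sel unfolding Y_def by blast
  \<comment> \<open>An element of \<open>Y\<close> has the form \<open>F (a, b)\<close>, and
    selectivity at \<open>a, b, a, b\<close> gives its idempotence.\<close>
  show "idempotent_op Y (restrict F (Y \<times> Y))"
    using sel by (auto simp: idempotent_op_def selective14_def Y_def)
qed

theorem theorem4p11:
  fixes X Y :: "'a set" and F F' :: "'a \<times> 'a \<Rightarrow> 'a"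
  assumes "X \<noteq> {}"
    and "F \<in> X \<times> X \<rightarrow> X"
    and "Y = F ` (X \<times> X)"
    and "F' = restrict F (Y \<times> Y)"
  shows
    "(selective14 X F
      \<longleftrightarrow>
        (\<forall>u\<in>X. \<forall>v\<in>X. F (u, v) = F (F (u, u), F (v, v)))
        \<and> (selective14 Y F'
           \<and> (anticommutative_op Y F' \<or> F' ` (Y \<times> Y) = Y \<or> idempotent_op Y F'
              \<or> equiv Y (sim1 Y F') \<or> equiv Y (sim2 Y F')))
        \<and> (equiv Y (sim1 Y F') \<and> equiv Y (sim2 Y F')
           \<and> (\<forall>x\<in>Y. \<forall>y\<in>Y. sim2 Y F' `` {x} \<inter> sim1 Y F' `` {y} = {F' (x, y)}))
        \<and> (equiv Y (sim1 Y F') \<and> equiv Y (sim2 Y F')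
           \<and> (\<forall>x\<in>Y. \<forall>y\<in>Y. \<forall>z\<in>Y. x \<in> sim1 Y F' `` {y} \<longrightarrow>
                (\<exists>!u. u \<in> sim1 Y F' `` {z} \<and> (x, u) \<in> sim2 Y F'))
           \<and> (\<forall>x\<in>Y. \<forall>y\<in>Y. \<forall>z\<in>Y. (y, z) \<in> sim1 Y F' \<longrightarrow> F' (x, y) = F' (x, z))))
     \<and>
     (selective14 X F
      \<longleftrightarrow>
        (\<forall>u\<in>X. \<forall>v\<in>X. F (u, v) = F (F (u, u), F (v, v)))
        \<and> (equiv Y (sim1 Y F') \<and> equiv Y (sim2 Y F')
           \<and> (\<forall>x\<in>Y. \<forall>y\<in>Y. \<exists>f. bij_betw f (sim1 Y F' `` {x}) (sim1 Y F' `` {y})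
                \<and> (\<forall>u\<in>sim1 Y F' `` {x}. \<forall>v\<in>sim1 Y F' `` {y}.
                     f u = v \<longleftrightarrow> (u, v) \<in> sim2 Y F')))
        \<and> (\<forall>x\<in>Y. \<forall>y\<in>Y. \<forall>z\<in>Y. (y, z) \<in> sim1 Y F' \<longrightarrow> F' (x, y) = F' (x, z)))"
proof -
  define P where "P \<longleftrightarrow> (\<forall>u\<in>X. \<forall>v\<in>X. F (u, v) = F (F (u, u), F (v, v)))"
  have iff: "selective14 X F \<longleftrightarrow> P \<and> selective14 Y F'"
    unfolding P_def assms(3,4) by (rule selective14_range_iff[OF assms(2)])
  have band: "rectangular_band Y F'" if "selective14 X F"
    unfolding assms(3,4) by (rule rectangular_band_range[OF assms(2) that])
  let ?eqs = "equiv Y (sim1 Y F') \<and> equiv Y (sim2 Y F')"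
  let ?inter = "\<forall>x\<in>Y. \<forall>y\<in>Y. sim2 Y F' `` {x} \<inter> sim1 Y F' `` {y} = {F' (x, y)}"
  let ?ex1 = "\<forall>x\<in>Y. \<forall>y\<in>Y. \<forall>z\<in>Y. x \<in> sim1 Y F' `` {y} \<longrightarrow>
                (\<exists>!u. u \<in> sim1 Y F' `` {z} \<and> (x, u) \<in> sim2 Y F')"
  let ?cong = "\<forall>x\<in>Y. \<forall>y\<in>Y. \<forall>z\<in>Y. (y, z) \<in> sim1 Y F' \<longrightarrow> F' (x, y) = F' (x, z)"
  let ?bij = "\<forall>x\<in>Y. \<forall>y\<in>Y. \<exists>f. bij_betw f (sim1 Y F' `` {x}) (sim1 Y F' `` {y})
                \<and> (\<forall>u\<in>sim1 Y F' `` {x}. \<forall>v\<in>sim1 Y F' `` {y}.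
                     f u = v \<longleftrightarrow> (u, v) \<in> sim2 Y F')"
  \<comment> \<open>Everything that (ii) and (iii) demand of \<open>F'\<close> beyond selectivity;
    idempotence settles the disjunction in (ii.1).\<close>
  have forward: "idempotent_op Y F' \<and> ?eqs \<and> ?inter \<and> ?ex1 \<and> ?cong \<and> ?bij" if "selective14 X F"
  proof -
    interpret rectangular_band Y F' by (rule band[OF that])
    have ?bij
    proof (intro ballI exI conjI)
      fix x y assume xy: "x \<in> Y" "y \<in> Y"
      then show "bij_betw (\<lambda>u. F' (u, y)) (sim1 Y F' `` {x}) (sim1 Y F' `` {y})"
        by (rule class_bij)
      fix u v assume "u \<in> sim1 Y F' `` {x}" and v: "v \<in> sim1 Y F' `` {y}"
      then have "u \<in> Y" by (auto simp: sim1_def)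
      then show "F' (u, y) = v \<longleftrightarrow> (u, v) \<in> sim2 Y F'" by (rule class_bij_graph[OF _ xy(2) v])
    qed
    moreover have ?inter by (simp add: class_inter)
    moreover have ?ex1 using ex1_class by blast
    moreover have ?cong using sim1_cong by blast
    ultimately show ?thesis using idempotent equiv_sim1 equiv_sim2 by blast
  qed
  \<comment> \<open>This is the way back from (iii); in (ii), selectivity of \<open>F'\<close> is
    already part of (ii.1).\<close>
  have backward: "selective14 Y F'" if eqs: ?eqs and bij: ?bij and cong: ?cong
  proof (rule selective14_if_sim_product)
    show "equiv Y (sim1 Y F')" "equiv Y (sim2 Y F')" using eqs by auto
    show "\<exists>v. (y, v) \<in> sim1 Y F' \<and> (x, v) \<in> sim2 Y F'" if xy: "x \<in> Y" "y \<in> Y" for x y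
    proof -
      \<comment> \<open>The required common element is \<open>f x\<close>: it lies in the class of
        \<open>y\<close>, and the rule defining \<open>f\<close>, taken at \<open>v = f x\<close>,
        relates \<open>x\<close> to it.\<close>
      obtain f where f: "bij_betw f (sim1 Y F' `` {x}) (sim1 Y F' `` {y})"
        "\<forall>u\<in>sim1 Y F' `` {x}. \<forall>v\<in>sim1 Y F' `` {y}. f u = v \<longleftrightarrow> (u, v) \<in> sim2 Y F'"
        using bij[rule_format, OF xy] by (elim exE conjE)
      have "x \<in> sim1 Y F' `` {x}" using equiv_class_self[OF conjunct1[OF eqs] xy(1)] .
      then have "f x \<in> sim1 Y F' `` {y}" "(x, f x) \<in> sim2 Y F'"
        using f bij_betwE[OF f(1)] by blast+
      then show ?thesis by blast
    qed
    show "F' (x, y) = F' (x, z)" if "x \<in> Y" "(y, z) \<in> sim1 Y F'" for x y z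
      using cong that unfolding sim1_def by blast
  qed
  show ?thesis
    unfolding P_def[symmetric]
    \<comment> \<open>With the quantified conditions as atoms, only propositional reasoning
      remains.\<close>
    using iff forward backward by argo
qed

end
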